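(* There exists an absolute constant $c>0$ such that for all integers $s\ge 3$, $F_{2}(2,s,s)\le c\, s\log s$.
   Context: For integers $d\ge1$, $r\ge2$ and $s_1,\ldots,s_r\ge1$, $F_r(d,s_1,\ldots,s_r)$ is the least integer $n$ such that every $n$-point set $P\subseteq\mathbb{R}^d$ admits a partition $P=P_1\sqcup\cdots\sqcup P_r$ with the following property: whenever, for each $i\in[r]$, $C_i=\bigcup_{j=1}^{s_i}C_{i,j}$ where the $C_{i,j}$ ($j\in[s_i]$) are convex sets with $C_{i,j}\cap C_{i,j'}=\emptyset$ for all $j\neq j'$, and $P_i\subseteq C_i$, then $\bigcap_{i=1}^r C_i\neq\emptyset$. *)

theory Defs
  imports "HOL-Analysis.Analysis"
begin

text \<open>Pieces are allowed to be empty, as in the usual convention for convex sets.\<close>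

definition disjoint_convex_union :: "nat \<Rightarrow> 'a::real_vector set \<Rightarrow> bool" where
  "disjoint_convex_union k C \<longleftrightarrow>
     (\<exists>D. (\<forall>j\<in>{1..k}. convex (D j)) \<and> disjoint_family_on D {1..k} \<and> C = (\<Union>j\<in>{1..k}. D j))"

definition unavoidable_partition ::
  "nat \<Rightarrow> (nat \<Rightarrow> nat) \<Rightarrow> 'a::real_vector set \<Rightarrow> (nat \<Rightarrow> 'a set) \<Rightarrow> bool" where
  "unavoidable_partition r s P Q \<longleftrightarrow>
     disjoint_family_on Q {1..r} \<and> (\<Union>i\<in>{1..r}. Q i) = P \<and>
     (\<forall>C. (\<forall>i\<in>{1..r}. disjoint_convex_union (s i) (C i) \<and> Q i \<subseteq> C i)
        \<longrightarrow> (\<Inter>i\<in>{1..r}. C i) \<noteq> {})"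

text \<open>
  \<open>F TYPE('d) r s\<close> is $F_r(d, s_1, \ldots, s_r)$ with \<open>d = CARD('d)\<close>; only the values of
  \<open>s\<close> on \<open>{1..r}\<close> matter. The least \<open>n\<close> is taken in \<^typ>\<open>enat\<close>, so that the value
  is \<open>\<infinity>\<close> if no \<open>n\<close> works; a finite upper bound therefore includes the existence of such an \<open>n\<close>.
\<close>

definition F :: "'d::finite itself \<Rightarrow> nat \<Rightarrow> (nat \<Rightarrow> nat) \<Rightarrow> enat" where
  "F _ r s =
     (INF n \<in> {n. \<forall>P :: (real ^ 'd) set. finite P \<and> card P = n
                    \<longrightarrow> (\<exists>Q. unavoidable_partition r s P Q)}. enat n)"

end

theory Submission
  imports Defs
begin

text \<open>
  If a bipartition \<open>(A, P - A)\<close> is avoidable, then \<open>P\<close> is covered by \<open>2 * s\<close> disjoint convex hulls,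
  each of one colour. Sweep a vertical line over them. While the upper and lower neighbours of a
  hull do not change, the points of that hull are cut out of \<open>P\<close> by two verticals and two separating
  lines. A change of neighbours is caused by the birth or death of a hull, so \<open>10 * s\<close> such trapezoids
  suffice. A set of \<open>n\<close> points has polynomially many traces of trapezoids, hence only \<open>n\<close> to the power
  \<open>O(s)\<close> avoidable bipartitions, which is less than \<open>2 ^ n\<close> once \<open>n\<close> is a large multiple of \<open>s * ln s\<close>.
\<close>

section \<open>Neighbours in a family of graphs over intervals\<close>

text \<open>Abstracts disjoint convex sets met by a moving vertical line: lifetimes are intervals,
  and two members keep their vertical order wherever both live. Only the times in the finite set
  \<open>X\<close> are observed.\<close>

locale sweep =
  fixes I :: "'i set" and X :: "real set"
    and alive :: "'i \<Rightarrow> real \<Rightarrow> bool" and h :: "'i \<Rightarrow> real \<Rightarrow> real"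
  assumes finite_I: "finite I" and finite_X: "finite X"
    and alive_I: "alive i t \<Longrightarrow> i \<in> I"
    and alive_between: "alive i a \<Longrightarrow> alive i b \<Longrightarrow> a \<le> t \<Longrightarrow> t \<le> b \<Longrightarrow> alive i t"
    and h_inj: "alive i t \<Longrightarrow> alive j t \<Longrightarrow> h i t = h j t \<Longrightarrow> i = j"
    and h_order: "alive i t \<Longrightarrow> alive j t \<Longrightarrow> alive i t' \<Longrightarrow> alive j t' \<Longrightarrow>
                  h i t < h j t \<Longrightarrow> h i t' < h j t'"
begin

definition above :: "'i \<Rightarrow> real \<Rightarrow> 'i set" where
  "above i t = {j. alive j t \<and> h i t < h j t}"

definition up :: "'i \<Rightarrow> real \<Rightarrow> 'i option" where
  "up i t = (if above i t = {} then None else Some (arg_min_on (\<lambda>j. h j t) (above i t)))"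

definition adj :: "real \<Rightarrow> real \<Rightarrow> bool" where
  "adj t t' \<longleftrightarrow> t \<in> X \<and> t' \<in> X \<and> t < t' \<and> (\<forall>s\<in>X. s \<le> t \<or> t' \<le> s)"

lemma finite_above: "finite (above i t)"
  using alive_I by (auto simp: above_def intro: finite_subset[OF _ finite_I])

lemma up_SomeD:
  assumes "up i t = Some j"
  shows "alive j t" "h i t < h j t" "\<And>l. alive l t \<Longrightarrow> h i t < h l t \<Longrightarrow> h j t \<le> h l t"
proof -
  have ne: "above i t \<noteq> {}" and j: "j = arg_min_on (\<lambda>j. h j t) (above i t)"
    using assms by (auto simp: up_def split: if_splits)
  have "j \<in> above i t"
    using arg_min_if_finite(1)[OF finite_above ne] j by blast
  then show "alive j t" "h i t < h j t"
    by (auto simp: above_def)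
  show "h j t \<le> h l t" if "alive l t" "h i t < h l t" for l
    using arg_min_if_finite(2)[OF finite_above ne, of "\<lambda>j. h j t"] j that
    by (force simp: above_def)
qed

lemma up_NoneD:
  assumes "up i t = None" "alive l t"
  shows "h l t \<le> h i t"
  using assms by (auto simp: up_def above_def split: if_splits)

text \<open>Of two members below the same upper neighbour, the higher one would lie strictly between
  the lower one and that neighbour.\<close>

lemma up_inj:
  assumes "up i t = Some d" "up i' t = Some d" "alive i t" "alive i' t"
  shows "i = i'"
proof (rule ccontr)
  assume "i \<noteq> i'"
  then have "h i t \<noteq> h i' t" using h_inj assms by blast
  then show False
    using up_SomeD(2)[OF assms(1)] up_SomeD(2)[OF assms(2)]
      up_SomeD(3)[OF assms(1) assms(4)] up_SomeD(3)[OF assms(2) assms(3)] by linarith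
qed

text \<open>Suppose the old and the new neighbour live at both times. By \<open>h_order\<close> each
  lies above \<open>i\<close> at both, so minimality puts the old one lower at \<open>t\<close> and
  the new one lower at \<open>t'\<close>, against \<open>h_order\<close>.\<close>

lemma up_change:
  assumes "alive i t" "alive i t'" "up i t \<noteq> up i t'"
  shows "(\<exists>d. up i t = Some d \<and> \<not> alive d t') \<or> (\<exists>b. up i t' = Some b \<and> \<not> alive b t)"
proof (rule ccontr)
  assume "\<not> ?thesis"
  then have A: "\<And>d. up i t = Some d \<Longrightarrow> alive d t'" and B: "\<And>b. up i t' = Some b \<Longrightarrow> alive b t"
    by auto
  \<comment> \<open>A neighbour at \<open>s'\<close> that lives at \<open>s\<close> is above
    \<open>i\<close> there too, so it competes for being the neighbour at \<open>s\<close>.\<close>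
  have C: "\<exists>u. up i s = Some u \<and> h u s \<le> h v s"
    if "up i s' = Some v" "alive v s" "alive i s" "alive i s'" for s s' v
  proof -
    have "h i s < h v s"
      using h_order up_SomeD(1,2)[OF that(1)] that by blast
    then show ?thesis
      using up_NoneD[of i s v] up_SomeD(3)[of i s _ v] that(2)
      by (cases "up i s") auto
  qed
  show False
  proof (cases "up i t")
    case None
    then obtain v where "up i t' = Some v" using assms(3) by (cases "up i t'") auto
    then show False using C[of t' v t] B assms None by auto
  next
    case (Some u)
    then obtain v where v: "up i t' = Some v" "h v t' \<le> h u t'"
      using C[of t u t'] A assms by blast
    have "h u t \<le> h v t" using C[of t' v t] B v(1) assms Some by auto
    moreover have "u \<noteq> v" using v Some assms by auto
    moreover have "alive u t" "alive u t'" "alive v t" "alive v t'"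
      using A B Some v up_SomeD(1) by auto
    ultimately show False
      using h_order[of u t v t'] h_inj[of u t v] v(2) by force
  qed
qed

section \<open>Consecutive observed times, births and deaths\<close>

lemma adj_unique:
  "adj t u \<Longrightarrow> adj t u' \<Longrightarrow> u = u'" "adj t u \<Longrightarrow> adj t' u \<Longrightarrow> t = t'"
  unfolding adj_def by force+

lemma adj_le:
  assumes "adj t u" "s \<in> X" "\<not> s \<le> t"
  shows "u \<le> s"
  using assms by (auto simp: adj_def)

text \<open>A lifetime is an interval, so a member that dies in one step cannot be alive at the
  start of a later one.\<close>

lemma death_unique:
  assumes "adj t u" "adj t' u'" "alive d t" "\<not> alive d u" "alive d t'" "\<not> alive d u'"
  shows "t = t'"
proof (rule ccontr)
  assume "t \<noteq> t'"
  then consider "t < t'" | "t' < t" by linarith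
  then show False
  proof cases
    case 1
    then have "u \<le> t'" using adj_le[OF assms(1), of t'] assms(2) by (auto simp: adj_def)
    then show False using alive_between[OF assms(3,5), of u] assms(1,4) by (auto simp: adj_def)
  next
    case 2
    then have "u' \<le> t" using adj_le[OF assms(2), of t] assms(1) by (auto simp: adj_def)
    then show False using alive_between[OF assms(5,3), of u'] assms(2,6) by (auto simp: adj_def)
  qed
qed

text \<open>A member alive at the least element of \<open>X\<close> counts as born there, because
  the condition on predecessors is then vacuous.\<close>

definition birth :: "'i \<Rightarrow> real \<Rightarrow> bool" where
  "birth i u \<longleftrightarrow> u \<in> X \<and> alive i u \<and> (\<forall>t. adj t u \<longrightarrow> \<not> alive i t)"

lemma adj_exists:
  assumes "s \<in> X" "u \<in> X" "s < u"
  shows "\<exists>t. adj t u \<and> s \<le> t"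
proof -
  let ?A = "{t\<in>X. t < u}"
  have fin: "finite ?A" and ne: "?A \<noteq> {}" using finite_X assms by auto
  have "Max ?A \<in> ?A" using Max_in[OF fin ne] .
  moreover have "s \<le> Max ?A" using Max_ge[OF fin] assms by auto
  moreover have "v \<le> Max ?A \<or> u \<le> v" if "v \<in> X" for v
    using Max_ge[OF fin, of v] that by auto
  ultimately show ?thesis unfolding adj_def using assms by blast
qed

lemma birth_unique:
  assumes "birth i u" "birth i u'"
  shows "u = u'"
proof -
  have "\<not> v < w" if vw: "birth i v" "birth i w" for v w
  proof
    assume "v < w"
    then obtain t where "adj t w" "v \<le> t"
      using adj_exists[of v w] vw by (auto simp: birth_def)
    then show False
      using alive_between[of i v w t] vw by (auto simp: birth_def adj_def)
  qed
  then show ?thesis using assms by (meson linorder_neqE_linordered_idom)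
qed

text \<open>A change is recorded at the later of the two consecutive times, which is where a new
  block has to start.\<close>

definition up_changes :: "('i \<times> real) set" where
  "up_changes = {(i,u). alive i u \<and> (\<exists>t. adj t u \<and> alive i t \<and> up i t \<noteq> up i u)}"

text \<open>A change is charged to the old upper neighbour if it dies and to the new one if it is born;
  a member is charged at most once in each role.\<close>

lemma card_up_changes: "finite up_changes" "card up_changes \<le> 2 * card I"
proof -
  define RD where "RD a d \<longleftrightarrow> (\<exists>t. adj t (snd a) \<and> alive (fst a) t \<and>
      up (fst a) t = Some d \<and> \<not> alive d (snd a))" for a :: "'i \<times> real" and d
  define RB where "RB a d \<longleftrightarrow> birth d (snd a) \<and> alive (fst a) (snd a) \<and>
      up (fst a) (snd a) = Some d" for a :: "'i \<times> real" and d
  let ?D = "{a \<in> up_changes. \<exists>d. RD a d}" and ?B = "{a \<in> up_changes. \<exists>d. RB a d}"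
  have "up_changes \<subseteq> I \<times> X"
    using alive_I unfolding up_changes_def adj_def by blast
  then show fin: "finite up_changes"
    using finite_subset finite_I finite_X by blast
  have "card ?D \<le> card I"
  proof (rule card_le_if_inj_on_rel[where r = RD])
    show "\<exists>d. d \<in> I \<and> RD a d" if "a \<in> ?D" for a
      using that up_SomeD(1) alive_I unfolding RD_def by blast
    show "a = a'" if D: "RD a d" "RD a' d" for a a' d
    proof -
      obtain t where t: "adj t (snd a)" "alive (fst a) t" "up (fst a) t = Some d" "\<not> alive d (snd a)"
        using D(1) unfolding RD_def by blast
      obtain t' where t': "adj t' (snd a')" "alive (fst a') t'" "up (fst a') t' = Some d"
          "\<not> alive d (snd a')"
        using D(2) unfolding RD_def by blast
      \<comment> \<open>\<open>d\<close> dies in only one step, and just before it only one member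
        has \<open>d\<close> as its upper neighbour.\<close>
      have "t = t'"
        using death_unique[OF t(1) t'(1) up_SomeD(1)[OF t(3)] t(4) up_SomeD(1)[OF t'(3)] t'(4)] .
      then show ?thesis
        using up_inj[OF t(3) _ t(2), of "fst a'"] t' adj_unique(1)[OF t(1), of "snd a'"]
        by (auto simp: prod_eq_iff)
    qed
  qed (use finite_I in auto)
  moreover have "card ?B \<le> card I"
  proof (rule card_le_if_inj_on_rel[where r = RB])
    show "\<exists>d. d \<in> I \<and> RB a d" if "a \<in> ?B" for a
      using that up_SomeD(1) alive_I unfolding RB_def by blast
    show "a = a'" if B: "RB a d" "RB a' d" for a a' d
    proof -
      have "snd a = snd a'"
        using B birth_unique unfolding RB_def by blast
      then show ?thesis
        using B up_inj[of "fst a" "snd a" d "fst a'"] unfolding RB_def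
        by (auto simp: prod_eq_iff)
    qed
  qed (use finite_I in auto)
  moreover have "up_changes \<subseteq> ?D \<union> ?B"
  proof
    fix a assume a: "a \<in> up_changes"
    obtain i u t where t: "a = (i,u)" "alive i u" "adj t u" "alive i t" "up i t \<noteq> up i u"
      using a unfolding up_changes_def by blast
    from up_change[OF t(4,2,5)] have "(\<exists>d. RD a d) \<or> (\<exists>d. RB a d)"
    proof (elim disjE exE conjE)
      fix d assume "up i t = Some d" "\<not> alive d u"
      then show ?thesis using t unfolding RD_def by auto
    next
      fix d assume d: "up i u = Some d" "\<not> alive d t"
      \<comment> \<open>\<open>t\<close> is the only predecessor of \<open>u\<close> in
        \<open>X\<close>, so absence at \<open>t\<close> makes \<open>u\<close> the birth of
        \<open>d\<close>.\<close>
      have "birth d u"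
        unfolding birth_def
        using up_SomeD(1)[OF d(1)] d(2) t(3) adj_unique(2)[OF t(3)] adj_def by blast
      then show ?thesis using t d unfolding RB_def by auto
    qed
    then show "a \<in> ?D \<union> ?B" using a by blast
  qed
  then have "card up_changes \<le> card (?D \<union> ?B)"
    using fin by (intro card_mono) auto
  moreover have "card (?D \<union> ?B) \<le> card ?D + card ?B" by (rule card_Un_le)
  ultimately show "card up_changes \<le> 2 * card I" by linarith
qed

lemma card_births: "finite {(i,u). birth i u}" "card {(i,u). birth i u} \<le> card I"
proof -
  have "{(i,u). birth i u} \<subseteq> I \<times> X"
    using alive_I unfolding birth_def by blast
  then show "finite {(i,u). birth i u}"
    using finite_subset finite_I finite_X by blast
  show "card {(i,u). birth i u} \<le> card I"
  proof (rule card_le_if_inj_on_rel[where r = "\<lambda>a j. fst a = j"])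
    show "\<exists>j. j \<in> I \<and> fst a = j" if "a \<in> {(i,u). birth i u}" for a
      using that alive_I unfolding birth_def by auto
  qed (use finite_I birth_unique in auto)
qed

text \<open>Turning the picture upside down transfers every result on upper neighbours to lower
  neighbours.\<close>

lemma sweep_uminus: "sweep I X alive (\<lambda>i t. - h i t)"
proof
  show "i = j" if "alive i t" "alive j t" "- h i t = - h j t" for i j t
    using h_inj[of i t j] that by simp
  show "- h i t' < - h j t'"
    if "alive i t" "alive j t" "alive i t'" "alive j t'" "- h i t < - h j t" for i j t t'
    using h_order[of j t i t'] that by simp
qed (fact finite_I finite_X alive_I alive_between)+

section \<open>Lifetimes cut into stable blocks\<close>

abbreviation down :: "'i \<Rightarrow> real \<Rightarrow> 'i option" where
  "down \<equiv> sweep.up alive (\<lambda>i t. - h i t)"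

definition stable :: "'i \<Rightarrow> real \<Rightarrow> real \<Rightarrow> bool" where
  "stable i a b \<longleftrightarrow> a \<le> b \<and>
     (\<forall>t\<in>X. a \<le> t \<and> t \<le> b \<longrightarrow> alive i t \<and> up i t = up i a \<and> down i t = down i a)"

text \<open>A block starts at each birth and at each change of a neighbour. There are at most
  \<open>card I\<close> births and at most \<open>2 * card I\<close> changes on either side, which
  gives the factor 5.\<close>

theorem stable_blocks:
  "\<exists>B. finite B \<and> card B \<le> 5 * card I \<and> B \<subseteq> I \<times> X \<times> X \<and>
     (\<forall>(i,a,b)\<in>B. stable i a b) \<and>
     (\<forall>i. \<forall>t\<in>X. alive i t \<longrightarrow> (\<exists>a b. (i,a,b) \<in> B \<and> a \<le> t \<and> t \<le> b))"
proof -
  interpret d: sweep I X alive "\<lambda>i t. - h i t" by (rule sweep_uminus)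
  define S where "S = {(i,u). birth i u} \<union> up_changes \<union> d.up_changes"
  \<comment> \<open>The block that starts at \<open>a\<close> is extended to the right as far as
    stability lasts.\<close>
  define e where "e i a = Max {b\<in>X. stable i a b}" for i a
  have e: "e i a \<in> X" "stable i a (e i a)" "\<And>b. b \<in> X \<Longrightarrow> stable i a b \<Longrightarrow> b \<le> e i a"
    if "a \<in> X" "alive i a" for i a
  proof -
    have fin: "finite {b\<in>X. stable i a b}" using finite_X by auto
    moreover have "{b\<in>X. stable i a b} \<noteq> {}"
      using that by (auto simp: stable_def intro!: exI[of _ a])
    ultimately have "e i a \<in> {b\<in>X. stable i a b}"
      unfolding e_def by (rule Max_in)
    then show "e i a \<in> X" "stable i a (e i a)" by auto
    show "b \<le> e i a" if "b \<in> X" "stable i a b" for b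
      unfolding e_def using Max_ge[OF fin] that by auto
  qed
  have S: "alive i a" "a \<in> X" if "(i,a) \<in> S" for i a
    using that by (auto simp: S_def birth_def up_changes_def d.up_changes_def adj_def d.adj_def)
  have finS: "finite S"
    using card_births card_up_changes d.card_up_changes by (simp add: S_def)
  have cardS: "card S \<le> 5 * card I"
  proof -
    have "card S \<le> card {(i,u). birth i u} + card up_changes + card d.up_changes"
      unfolding S_def by (meson card_Un_le add_right_mono order_trans)
    then show ?thesis using card_births card_up_changes d.card_up_changes by linarith
  qed
  let ?B = "(\<lambda>(i,a). (i, a, e i a)) ` S"
  have cover: "\<exists>a b. (i,a,b) \<in> ?B \<and> a \<le> t \<and> t \<le> b" if t: "t \<in> X" and al: "alive i t" for i t
  proof -
    \<comment> \<open>The earliest \<open>a\<close> from which \<open>i\<close> is stable until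
      \<open>t\<close> is a start: otherwise its predecessor in \<open>X\<close> has the same
      neighbours and could be added to the block.\<close>
    let ?A = "{a\<in>X. a \<le> t \<and> stable i a t}"
    have fin: "finite ?A" using finite_X by auto
    have ne: "?A \<noteq> {}" using t al by (auto simp: stable_def intro!: exI[of _ t])
    define a where "a = Min ?A"
    have a: "a \<in> X" "a \<le> t" "stable i a t" using Min_in[OF fin ne] by (auto simp: a_def)
    have aa: "alive i a" using a by (auto simp: stable_def)
    have "(i,a) \<in> S"
    proof (rule ccontr)
      assume n: "(i,a) \<notin> S"
      then obtain s where s: "adj s a" "alive i s"
        using a aa by (auto simp: S_def birth_def)
      with n aa have eq: "up i s = up i a" "down i s = down i a"
        by (auto simp: S_def up_changes_def d.up_changes_def adj_def d.adj_def)
      have "alive i v \<and> up i v = up i s \<and> down i v = down i s"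
        if v: "v \<in> X" "s \<le> v" "v \<le> t" for v
      proof (cases "a \<le> v")
        case True
        then show ?thesis using a(3) v eq unfolding stable_def by simp
      next
        case False
        then have "v = s" using adj_le[OF s(1) v(1)] v(2) by linarith
        then show ?thesis using s(2) by simp
      qed
      moreover have "s \<le> t" using s(1) a(2) unfolding adj_def by linarith
      ultimately have "stable i s t" unfolding stable_def by blast
      then have "s \<in> ?A" using s a by (auto simp: adj_def)
      then have "a \<le> s" unfolding a_def using Min_le[OF fin] by blast
      then show False using s by (auto simp: adj_def)
    qed
    moreover have "t \<le> e i a" using e(3)[OF a(1) aa t a(3)] .
    ultimately show ?thesis using a(2) by force
  qed
  show ?thesis
  proof (intro exI[of _ ?B] conjI)
    show "card ?B \<le> 5 * card I" using card_image_le[OF finS] cardS le_trans by blast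
    show "?B \<subseteq> I \<times> X \<times> X" using S e(1) alive_I by fastforce
    show "\<forall>(i,a,b)\<in>?B. stable i a b" using S e(2) by fastforce
  qed (use cover finS in blast)+
qed

end

section \<open>Trapezoids\<close>

text \<open>A strictly separating line exists by compactness. It also separates two points of one
  vertical, so it is not vertical and can be solved for the second coordinate.\<close>

lemma strict_separation_on_vertical:
  fixes A B :: "(real^2) set"
  assumes "convex A" "compact A" "convex B" "closed B" "A \<inter> B = {}"
    and p: "p \<in> A" and q: "q \<in> B" and pq: "p$1 = q$1" "\<sigma> * p$2 < \<sigma> * q$2"
  shows "\<exists>\<alpha> \<gamma>. (\<forall>z\<in>A. \<sigma> * z$2 < \<alpha> * z$1 + \<gamma>) \<and> (\<forall>z\<in>B. \<alpha> * z$1 + \<gamma> < \<sigma> * z$2)"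
proof -
  obtain c d where c: "\<forall>z\<in>A. inner c z < d" "\<forall>z\<in>B. d < inner c z"
    using separating_hyperplane_compact_closed[of A B] assms by blast
  have in2: "inner c z = c$1 * z$1 + c$2 * z$2" for z
    by (simp add: inner_vec_def sum_2)
  have "0 < c$2 * (q$2 - p$2)"
    using c p q pq(1) unfolding in2 by (smt (verit) right_diff_distrib)
  moreover have "0 < \<sigma> * (q$2 - p$2)"
    using pq by (simp add: right_diff_distrib)
  \<comment> \<open>\<sigma> and \<open>c$2\<close> have the same sign, so scaling by their quotient
    keeps the inequalities and makes \<sigma> the coefficient of \<open>z$2\<close>.\<close>
  ultimately have m: "0 < \<sigma> / c$2" and c2: "c$2 \<noteq> 0"
    by (auto simp: zero_less_mult_iff zero_less_divide_iff)
  have eq: "\<sigma> * z$2 = \<sigma> / c$2 * inner c z - \<sigma> / c$2 * c$1 * z$1" for z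
    using c2 unfolding in2 by (simp add: field_simps)
  have "\<forall>z\<in>A. \<sigma> * z$2 < - (\<sigma> / c$2 * c$1) * z$1 + \<sigma> / c$2 * d"
    using c(1) mult_strict_left_mono[OF _ m] unfolding eq by fastforce
  moreover have "\<forall>z\<in>B. - (\<sigma> / c$2 * c$1) * z$1 + \<sigma> / c$2 * d < \<sigma> * z$2"
    using c(2) mult_strict_left_mono[OF _ m] unfolding eq by fastforce
  ultimately show ?thesis by blast
qed

text \<open>Points strictly below a non-vertical line for \<sigma> = 1, strictly above one for
  \<sigma> = -1.\<close>

definition halfplane_traces :: "real \<Rightarrow> (real^2) set \<Rightarrow> (real^2) set set" where
  "halfplane_traces \<sigma> P = {{p\<in>P. \<sigma> * p$2 < \<alpha> * p$1 + \<gamma>} |\<alpha> \<gamma>. True}"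

definition slab_traces :: "(real^2) set \<Rightarrow> (real^2) set set" where
  "slab_traces P = (\<lambda>(p,q). {z\<in>P. p$1 \<le> z$1 \<and> z$1 \<le> q$1}) ` (P \<times> P)"

text \<open>Inserting \<open>P\<close> allows a missing side, as for a hull without an upper or a
  lower neighbour.\<close>

definition trapezoid_traces :: "(real^2) set \<Rightarrow> (real^2) set set" where
  "trapezoid_traces P = (\<lambda>(L,U,J). L \<inter> U \<inter> J) `
     (insert P (halfplane_traces 1 P) \<times> insert P (halfplane_traces (-1) P) \<times> slab_traces P)"

section \<open>Disjoint compact convex sets as a sweep\<close>

locale disjoint_convex_family =
  fixes I :: "'i set" and K :: "'i \<Rightarrow> (real^2) set" and P :: "(real^2) set"
  assumes fin_I: "finite I" and fin_P: "finite P"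
    and convex_K: "i \<in> I \<Longrightarrow> convex (K i)" and compact_K: "i \<in> I \<Longrightarrow> compact (K i)"
    and disjoint_K: "i \<in> I \<Longrightarrow> j \<in> I \<Longrightarrow> i \<noteq> j \<Longrightarrow> K i \<inter> K j = {}"
    and P_covered: "P \<subseteq> (\<Union>i\<in>I. K i)"
begin

definition alive :: "'i \<Rightarrow> real \<Rightarrow> bool" where
  "alive i t \<longleftrightarrow> i \<in> I \<and> (\<exists>p\<in>K i. p$1 = t)"

text \<open>An arbitrary point of \<open>K i\<close> on the vertical line at \<open>t\<close>; unspecified unless \<open>alive i t\<close>.\<close>

definition pt :: "'i \<Rightarrow> real \<Rightarrow> real^2" where
  "pt i t = (SOME p. p \<in> K i \<and> p$1 = t)"

lemma pt:
  assumes "alive i t"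
  shows "pt i t \<in> K i" "pt i t $ 1 = t"
  using someI_ex[of "\<lambda>p. p \<in> K i \<and> p$1 = t"] assms unfolding pt_def alive_def by blast+

abbreviation X :: "real set" where "X \<equiv> (\<lambda>p. p$1) ` P"

text \<open>The separating line shows that the vertical order of two sets does not depend on the
  points chosen by \<open>pt\<close>.\<close>

lemma separation:
  assumes "alive i t" "alive j t" "\<sigma> * pt i t $ 2 < \<sigma> * pt j t $ 2"
  shows "\<exists>\<alpha> \<gamma>. (\<forall>z\<in>K i. \<sigma> * z$2 < \<alpha> * z$1 + \<gamma>) \<and> (\<forall>z\<in>K j. \<alpha> * z$1 + \<gamma> < \<sigma> * z$2)"
proof -
  have I: "i \<in> I" "j \<in> I" "i \<noteq> j" using assms unfolding alive_def by auto
  show ?thesis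
    by (rule strict_separation_on_vertical[of _ _ "pt i t" "pt j t"])
       (use I pt[OF assms(1)] pt[OF assms(2)] assms(3) convex_K compact_K disjoint_K compact_imp_closed[OF compact_K] in auto)
qed

text \<open>Lifetimes are projections of convex sets, hence intervals. One separating line fixes the
  order of two sets on all verticals that meet both.\<close>

lemma sweep_pt:
  assumes "\<sigma> \<noteq> 0"
  shows "sweep I X alive (\<lambda>i t. \<sigma> * pt i t $ 2)"
proof
  show "finite I" "finite X" using fin_I fin_P by auto
  show "i \<in> I" if "alive i t" for i t using that by (simp add: alive_def)
  show "alive i t" if al: "alive i a" "alive i b" and t: "a \<le> t" "t \<le> b" for i a b t
  proof -
    have "linear (\<lambda>p::real^2. p$1)" by (rule linearI) auto
    then have "convex ((\<lambda>p. p$1) ` K i)"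
      using al convex_K convex_linear_image unfolding alive_def by blast
    then have "is_interval ((\<lambda>p. p$1) ` K i)" by (simp add: is_interval_convex_1)
    moreover have "a \<in> (\<lambda>p. p$1) ` K i" "b \<in> (\<lambda>p. p$1) ` K i"
      using al unfolding alive_def by auto
    ultimately have "t \<in> (\<lambda>p. p$1) ` K i"
      using t unfolding is_interval_1 by blast
    then show ?thesis using al unfolding alive_def by auto
  qed
  show "i = j" if al: "alive i t" "alive j t" and eq: "\<sigma> * pt i t $ 2 = \<sigma> * pt j t $ 2" for i j t
  proof -
    have "pt i t $ 1 = pt j t $ 1" unfolding pt(2)[OF al(1)] pt(2)[OF al(2)] ..
    then have "pt i t = pt j t"
      using eq assms by (simp add: vec_eq_iff forall_2)
    then have "pt i t \<in> K i \<inter> K j"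
      using pt(1)[OF al(1)] pt(1)[OF al(2)] by simp
    then show ?thesis
      using al disjoint_K[of i j] unfolding alive_def by blast
  qed
  show "\<sigma> * pt i t' $ 2 < \<sigma> * pt j t' $ 2"
    if al: "alive i t" "alive j t" "alive i t'" "alive j t'" and less: "\<sigma> * pt i t $ 2 < \<sigma> * pt j t $ 2" for i j t t'
  proof -
    obtain \<alpha> \<gamma> where "\<forall>z\<in>K i. \<sigma> * z$2 < \<alpha> * z$1 + \<gamma>" "\<forall>z\<in>K j. \<alpha> * z$1 + \<gamma> < \<sigma> * z$2"
      using separation[OF al(1,2) less] by blast
    then have "\<sigma> * pt i t' $ 2 < \<alpha> * pt i t' $ 1 + \<gamma>" "\<alpha> * pt j t' $ 1 + \<gamma> < \<sigma> * pt j t' $ 2"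
      using pt(1)[OF al(3)] pt(1)[OF al(4)] by blast+
    then have "\<sigma> * pt i t' $ 2 < \<alpha> * t' + \<gamma>" "\<alpha> * t' + \<gamma> < \<sigma> * pt j t' $ 2"
      unfolding pt(2)[OF al(3)] pt(2)[OF al(4)] by blast+
    then show ?thesis by linarith
  qed
qed

text \<open>The sign of \<open>\<sigma>\<close> selects the upper or the lower neighbour.\<close>

lemma boundary_halfplane:
  fixes \<sigma> :: real
  defines "u \<equiv> sweep.up alive (\<lambda>i t. \<sigma> * pt i t $ 2)"
  assumes \<sigma>: "\<sigma> \<noteq> 0"
    and a: "alive i a"
    and stab: "\<And>t. t \<in> X \<Longrightarrow> a \<le> t \<Longrightarrow> t \<le> b \<Longrightarrow> alive i t \<and> u i t = u i a"
  shows "\<exists>L\<in>insert P (halfplane_traces \<sigma> P). P \<inter> K i \<subseteq> L \<and>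
           (\<forall>q\<in>L. \<forall>l\<in>I. q \<in> K l \<longrightarrow> a \<le> q$1 \<longrightarrow> q$1 \<le> b \<longrightarrow>
              \<sigma> * pt l (q$1) $ 2 \<le> \<sigma> * pt i (q$1) $ 2)"
proof -
  interpret sweep I X alive "\<lambda>i t. \<sigma> * pt i t $ 2" by (rule sweep_pt[OF \<sigma>])
  show ?thesis
  proof (cases "up i a")
    case None
    \<comment> \<open>By stability nothing lies beyond \<open>K i\<close> anywhere in the block, so
      \<open>P\<close> itself serves as the trace.\<close>
    have "\<sigma> * pt l (q$1) $ 2 \<le> \<sigma> * pt i (q$1) $ 2"
      if "q \<in> P" "l \<in> I" "q \<in> K l" "a \<le> q$1" "q$1 \<le> b" for q l
      using up_NoneD[of i "q$1" l] stab[of "q$1"] that None unfolding u_def alive_def by auto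
    then show ?thesis by blast
  next
    case (Some j)
    note j = up_SomeD(1,2)[OF Some]
    obtain \<alpha> \<gamma> where sep: "\<forall>z\<in>K i. \<sigma> * z$2 < \<alpha> * z$1 + \<gamma>" "\<forall>z\<in>K j. \<alpha> * z$1 + \<gamma> < \<sigma> * z$2"
      using separation[OF a j] by blast
    let ?L = "{p\<in>P. \<sigma> * p$2 < \<alpha> * p$1 + \<gamma>}"
    have "\<sigma> * pt l (q$1) $ 2 \<le> \<sigma> * pt i (q$1) $ 2"
      if q: "q \<in> ?L" "l \<in> I" "q \<in> K l" "a \<le> q$1" "q$1 \<le> b" for q l
    proof (rule ccontr)
      \<comment> \<open>If \<open>K l\<close> were beyond \<open>K i\<close> at this vertical, it
        would be beyond the neighbour \<open>K j\<close>, which stability keeps in place. Then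
        \<open>q\<close> would be beyond a point of \<open>K j\<close>, hence beyond the line that
        bounds \<open>?L\<close>.\<close>
      assume neg: "\<not> ?thesis"
      let ?t = "q$1"
      have al: "alive l ?t" using q unfolding alive_def by blast
      have Sj: "up i ?t = Some j" using stab[of ?t] q Some unfolding u_def by auto
      note aj = up_SomeD(1)[OF Sj]
      have le: "\<sigma> * pt j ?t $ 2 \<le> \<sigma> * pt l ?t $ 2"
        using up_SomeD(3)[OF Sj al] neg by linarith
      have "l \<noteq> j" using sep(2) q by force
      then have "\<sigma> * pt j ?t $ 2 \<noteq> \<sigma> * pt l ?t $ 2" using h_inj[OF aj al] by metis
      then obtain \<alpha>' \<gamma>' where sep': "\<forall>z\<in>K j. \<sigma> * z$2 < \<alpha>' * z$1 + \<gamma>'" "\<forall>z\<in>K l. \<alpha>' * z$1 + \<gamma>' < \<sigma> * z$2"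
        using separation[OF aj al] le by force
      have "\<sigma> * pt j ?t $ 2 < \<alpha>' * pt j ?t $ 1 + \<gamma>'" "\<alpha> * pt j ?t $ 1 + \<gamma> < \<sigma> * pt j ?t $ 2"
        using sep'(1) sep(2) pt(1)[OF aj] by blast+
      then have "\<sigma> * pt j ?t $ 2 < \<alpha>' * ?t + \<gamma>'" "\<alpha> * ?t + \<gamma> < \<sigma> * pt j ?t $ 2"
        unfolding pt(2)[OF aj] by blast+
      moreover have "\<alpha>' * ?t + \<gamma>' < \<sigma> * q$2" using sep'(2) q by blast
      ultimately show False using q by simp
    qed
    moreover have "P \<inter> K i \<subseteq> ?L" using sep by blast
    moreover have "?L \<in> halfplane_traces \<sigma> P" unfolding halfplane_traces_def by blast
    ultimately show ?thesis by blast
  qed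
qed

text \<open>Over a stable block of \<open>i\<close>, the lines separating \<open>K i\<close> from
  its two neighbours cut out exactly the points of \<open>P\<close> in \<open>K i\<close>: any such
  point lies in some \<open>K l\<close>, which is neither above nor below \<open>K i\<close> at its
  vertical.\<close>

theorem union_of_trapezoids:
  assumes "J \<subseteq> I"
  shows "\<exists>T. T \<subseteq> trapezoid_traces P \<and> finite T \<and> card T \<le> 5 * card I \<and> \<Union>T = P \<inter> (\<Union>i\<in>J. K i)"
proof -
  interpret sweep I X alive "\<lambda>i t. 1 * pt i t $ 2" by (rule sweep_pt) simp
  \<comment> \<open>Rewrites \<open>down\<close> as the neighbour function for \<sigma> = -1, so
    that \<open>boundary_halfplane\<close> covers both sides.\<close>
  have minus: "(\<lambda>i t. - (1 * pt i t $ 2)) = (\<lambda>i t. (-1) * pt i t $ 2)" by simp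
  obtain B where "finite B \<and> card B \<le> 5 * card I \<and> B \<subseteq> I \<times> X \<times> X \<and>
     (\<forall>(i,a,b)\<in>B. stable i a b) \<and>
     (\<forall>i. \<forall>t\<in>X. alive i t \<longrightarrow> (\<exists>a b. (i,a,b) \<in> B \<and> a \<le> t \<and> t \<le> b))"
    using stable_blocks ..
  then have B: "finite B" "card B \<le> 5 * card I" "B \<subseteq> I \<times> X \<times> X"
      "\<And>i a b. (i,a,b) \<in> B \<Longrightarrow> stable i a b"
      "\<And>i t. t \<in> X \<Longrightarrow> alive i t \<Longrightarrow> \<exists>a b. (i,a,b) \<in> B \<and> a \<le> t \<and> t \<le> b"
    by fast+
  define block where "block = (\<lambda>(i,a,b). {q \<in> P \<inter> K i. a \<le> q$1 \<and> q$1 \<le> b})"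
  define B' where "B' = {z\<in>B. fst z \<in> J}"
  have trap: "block (i,a,b) \<in> trapezoid_traces P" if iab: "(i,a,b) \<in> B" for i a b
  proof -
    have i: "i \<in> I" "a \<in> X" "b \<in> X" and st: "stable i a b" using B(3,4) iab by auto
    have al: "alive i a" using st i(2) unfolding stable_def by auto
    have neg_one: "(-1::real) \<noteq> 0" by simp
    have st1: "alive i t \<and> up i t = up i a"
      and st2: "alive i t \<and> sweep.up alive (\<lambda>i t. (-1) * pt i t $ 2) i t =
                  sweep.up alive (\<lambda>i t. (-1) * pt i t $ 2) i a"
      if t: "t \<in> X" "a \<le> t" "t \<le> b" for t
      using st t unfolding stable_def minus by blast+
    have "\<exists>L\<in>insert P (halfplane_traces 1 P). P \<inter> K i \<subseteq> L \<and>
           (\<forall>q\<in>L. \<forall>l\<in>I. q \<in> K l \<longrightarrow> a \<le> q$1 \<longrightarrow> q$1 \<le> b \<longrightarrow>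
              1 * pt l (q$1) $ 2 \<le> 1 * pt i (q$1) $ 2)"
      by (rule boundary_halfplane[OF one_neq_zero al]) (rule st1)
    then obtain L where L: "L \<in> insert P (halfplane_traces 1 P)" "P \<inter> K i \<subseteq> L"
        "\<forall>q\<in>L. \<forall>l\<in>I. q \<in> K l \<longrightarrow> a \<le> q$1 \<longrightarrow> q$1 \<le> b \<longrightarrow>
           1 * pt l (q$1) $ 2 \<le> 1 * pt i (q$1) $ 2"
      by (elim bexE conjE) (rule that)
    have "\<exists>U\<in>insert P (halfplane_traces (-1) P). P \<inter> K i \<subseteq> U \<and>
           (\<forall>q\<in>U. \<forall>l\<in>I. q \<in> K l \<longrightarrow> a \<le> q$1 \<longrightarrow> q$1 \<le> b \<longrightarrow>
              (-1) * pt l (q$1) $ 2 \<le> (-1) * pt i (q$1) $ 2)"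
      by (rule boundary_halfplane[OF neg_one al]) (rule st2)
    then obtain U where U: "U \<in> insert P (halfplane_traces (-1) P)" "P \<inter> K i \<subseteq> U"
        "\<forall>q\<in>U. \<forall>l\<in>I. q \<in> K l \<longrightarrow> a \<le> q$1 \<longrightarrow> q$1 \<le> b \<longrightarrow>
           (-1) * pt l (q$1) $ 2 \<le> (-1) * pt i (q$1) $ 2"
      by (elim bexE conjE) (rule that)
    let ?S = "{z\<in>P. a \<le> z$1 \<and> z$1 \<le> b}"
    have "?S \<in> slab_traces P"
    proof -
      obtain p q where "p \<in> P" "q \<in> P" "a = p$1" "b = q$1" using i by blast
      then show ?thesis unfolding slab_traces_def by blast
    qed
    moreover have "block (i,a,b) = L \<inter> U \<inter> ?S"
    proof
      show "block (i,a,b) \<subseteq> L \<inter> U \<inter> ?S" using L(2) U(2) unfolding block_def by auto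
      show "L \<inter> U \<inter> ?S \<subseteq> block (i,a,b)"
      proof
        fix q assume q: "q \<in> L \<inter> U \<inter> ?S"
        then obtain l where l: "l \<in> I" "q \<in> K l" using P_covered by blast
        have "alive l (q$1)" using l unfolding alive_def by blast
        moreover have "alive i (q$1)" using st q unfolding stable_def by auto
        \<comment> \<open>The bound from \<open>L\<close> and the reversed bound from
          \<open>U\<close> leave only equality.\<close>
        moreover have "1 * pt l (q$1) $ 2 = 1 * pt i (q$1) $ 2"
          using L(3) U(3) q l by force
        ultimately have "l = i" using h_inj by blast
        then show "q \<in> block (i,a,b)" using q l unfolding block_def by auto
      qed
    qed
    ultimately show ?thesis
      using L(1) U(1) unfolding trapezoid_traces_def
      by (intro image_eqI[of _ _ "(L, U, ?S)"]) (simp_all only: prod.case mem_Sigma_iff)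
  qed
  have fB': "finite B'" using B(1) by (simp add: B'_def)
  show ?thesis
  proof (intro exI[of _ "block ` B'"] conjI)
    show "block ` B' \<subseteq> trapezoid_traces P" using trap unfolding B'_def by force
    show "finite (block ` B')" using fB' by simp
    have "card (block ` B') \<le> card B'" using fB' by (rule card_image_le)
    also have "\<dots> \<le> card B" unfolding B'_def using B(1) by (intro card_mono) auto
    finally show "card (block ` B') \<le> 5 * card I" using B(2) by linarith
    show "\<Union> (block ` B') = P \<inter> (\<Union>i\<in>J. K i)"
    proof
      show "\<Union> (block ` B') \<subseteq> P \<inter> (\<Union>i\<in>J. K i)" unfolding block_def B'_def by fastforce
      show "P \<inter> (\<Union>i\<in>J. K i) \<subseteq> \<Union> (block ` B')"
      proof
        fix q assume "q \<in> P \<inter> (\<Union>i\<in>J. K i)"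
        then obtain i where q: "q \<in> P" "i \<in> J" "q \<in> K i" by blast
        then have "alive i (q$1)" using assms unfolding alive_def by blast
        then obtain a b where "(i,a,b) \<in> B" "a \<le> q$1" "q$1 \<le> b" using B(5)[of "q$1" i] q by blast
        then have "(i,a,b) \<in> B'" "q \<in> block (i,a,b)" using q by (auto simp: B'_def block_def)
        then show "q \<in> \<Union> (block ` B')" by blast
      qed
    qed
  qed
qed

end

section \<open>Counting\<close>

text \<open>The trace is determined by its size and by the number of slopes of point pairs below \<open>\<alpha>\<close>,
  since the latter fixes the order of the points by \<open>y p - \<alpha> * x p\<close>.\<close>

lemma card_halfplane_traces:
  fixes x y :: "'a \<Rightarrow> real" and P :: "'a set"
  assumes fin: "finite P"
  defines "H \<equiv> {{p\<in>P. y p < \<alpha> * x p + \<gamma>} |\<alpha> \<gamma>. True}"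
  shows "card H \<le> ((card P)\<^sup>2 + 1) * (card P + 1)"
proof -
  \<comment> \<open>Pairs with equal abscissae yield 0 through division by zero; the bound by the
    number of pairs still holds.\<close>
  define slopes where "slopes = (\<lambda>(p,q). (y p - y q) / (x p - x q)) ` (P \<times> P)"
  have fs: "finite slopes" unfolding slopes_def using fin by simp
  have cs: "card slopes \<le> (card P)\<^sup>2"
    unfolding slopes_def using card_image_le[OF finite_cartesian_product[OF fin fin]]
    by (simp add: card_cartesian_product power2_eq_square)
  define R where "R S k \<longleftrightarrow> (\<exists>\<alpha> \<gamma>. S = {p\<in>P. y p < \<alpha> * x p + \<gamma>} \<and>
      k = (card {\<sigma>\<in>slopes. \<sigma> < \<alpha>}, card S))" for S :: "'a set" and k
  have "card H \<le> card ({..(card P)\<^sup>2} \<times> {..card P})"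
  proof (rule card_le_if_inj_on_rel[where r = R])
    show "\<exists>k. k \<in> {..(card P)\<^sup>2} \<times> {..card P} \<and> R S k" if SH: "S \<in> H" for S
    proof -
      obtain \<alpha> \<gamma> where S: "S = {p\<in>P. y p < \<alpha> * x p + \<gamma>}" using SH unfolding H_def by blast
      have "card {\<sigma>\<in>slopes. \<sigma> < \<alpha>} \<le> (card P)\<^sup>2"
        using card_mono[OF fs, of "{\<sigma>\<in>slopes. \<sigma> < \<alpha>}"] cs by auto
      moreover have "card S \<le> card P" unfolding S using fin by (intro card_mono) auto
      ultimately show ?thesis using S unfolding R_def by auto
    qed
    show "S = S'" if k: "R S k" "R S' k" for S S' k
    proof -
      obtain \<alpha> \<gamma> where S: "S = {p\<in>P. y p < \<alpha> * x p + \<gamma>}" "k = (card {\<sigma>\<in>slopes. \<sigma> < \<alpha>}, card S)"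
        using k(1) unfolding R_def by blast
      obtain \<alpha>' \<gamma>' where S': "S' = {p\<in>P. y p < \<alpha>' * x p + \<gamma>'}" "k = (card {\<sigma>\<in>slopes. \<sigma> < \<alpha>'}, card S')"
        using k(2) unfolding R_def by blast
      have fS: "finite S" "finite S'" using fin S S' by auto
      \<comment> \<open>The sets of slopes below \<alpha> and below \<alpha>' are nested, so equal
        sizes make them equal.\<close>
      have same: "\<sigma> < \<alpha> \<longleftrightarrow> \<sigma> < \<alpha>'" if "\<sigma> \<in> slopes" for \<sigma>
      proof -
        have c: "card {\<sigma>\<in>slopes. \<sigma> < \<alpha>} = card {\<sigma>\<in>slopes. \<sigma> < \<alpha>'}"
          using S(2) S'(2) by simp
        have "{\<sigma>\<in>slopes. \<sigma> < \<alpha>} \<subseteq> {\<sigma>\<in>slopes. \<sigma> < \<alpha>'} \<or>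
              {\<sigma>\<in>slopes. \<sigma> < \<alpha>'} \<subseteq> {\<sigma>\<in>slopes. \<sigma> < \<alpha>}"
          by (cases "\<alpha> \<le> \<alpha>'") auto
        then have "{\<sigma>\<in>slopes. \<sigma> < \<alpha>} = {\<sigma>\<in>slopes. \<sigma> < \<alpha>'}"
          using c card_subset_eq[of "{\<sigma>\<in>slopes. \<sigma> < \<alpha>}"] card_subset_eq[of "{\<sigma>\<in>slopes. \<sigma> < \<alpha>'}"] fs
          by (metis (no_types, lifting) finite_subset mem_Collect_eq subsetI)
        then show ?thesis using that by blast
      qed
      \<comment> \<open>Otherwise \<alpha> and \<alpha>' order some \<open>p\<close> and
        \<open>q\<close> differently, and the slope of that pair lies strictly between them; equal
        abscissae are contradictory at once.\<close>
      have sub: "S \<subseteq> S' \<or> S' \<subseteq> S"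
      proof (rule ccontr)
        assume "\<not> ?thesis"
        then obtain p q where pq: "p \<in> S" "p \<notin> S'" "q \<in> S'" "q \<notin> S" by blast
        then have P: "p \<in> P" "q \<in> P" using S(1) S'(1) by auto
        have "y p < \<alpha> * x p + \<gamma>" "\<alpha>' * x p + \<gamma>' \<le> y p" "y q < \<alpha>' * x q + \<gamma>'" "\<alpha> * x q + \<gamma> \<le> y q"
          using pq S(1) S'(1) P by auto
        then have *: "y p - y q < \<alpha> * (x p - x q)" "\<alpha>' * (x p - x q) < y p - y q"
          by (auto simp: algebra_simps)
        have sl: "(y p - y q) / (x p - x q) \<in> slopes" "(y q - y p) / (x q - x p) \<in> slopes"
          using P unfolding slopes_def by auto
        consider "x p = x q" | "x p > x q" | "x p < x q" by linarith
        then show False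
        proof cases
          case 1 then show False using * by simp
        next
          case 2
          then have "(y p - y q) / (x p - x q) < \<alpha>" "\<alpha>' < (y p - y q) / (x p - x q)"
            using * by (auto simp: divide_less_eq less_divide_eq)
          then show False using same[OF sl(1)] by linarith
        next
          case 3
          then have "(y p - y q) / (x p - x q) > \<alpha>" "\<alpha>' > (y p - y q) / (x p - x q)"
            using * by (auto simp: divide_less_eq less_divide_eq)
          then show False using same[OF sl(1)] by linarith
        qed
      qed
      have "card S = card S'" using S(2) S'(2) by simp
      then show ?thesis using sub card_subset_eq fS by metis
    qed
  qed auto
  then show ?thesis by simp
qed

text \<open>The exponent is 4 + 4 + 2 for the two half-planes and the slab, plus 1 to absorb the
  empty set, which later serves as padding.\<close>

lemma card_trapezoid_traces:
  assumes fin: "finite P"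
  shows "card (insert {} (trapezoid_traces P)) \<le> (card P + 1) ^ 11"
    and "finite (trapezoid_traces P)"
proof -
  define n where "n = card P + 1"
  show fT: "finite (trapezoid_traces P)"
    by (rule finite_subset[of _ "Pow P"])
       (use fin in \<open>auto simp: trapezoid_traces_def halfplane_traces_def slab_traces_def\<close>)
  have fH: "finite (halfplane_traces \<sigma> P)" for \<sigma>
    by (rule finite_subset[of _ "Pow P"]) (use fin in \<open>auto simp: halfplane_traces_def\<close>)
  have fS: "finite (slab_traces P)" using fin by (simp add: slab_traces_def)
  \<comment> \<open>For empty \<open>P\<close> the intermediate bound is 2 and exceeds
    \<open>n ^ 4 = 1\<close>, so that case is treated separately.\<close>
  have H: "card (insert P (halfplane_traces \<sigma> P)) \<le> n ^ 4" if "0 < card P" for \<sigma>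
  proof -
    have "card (insert P (halfplane_traces \<sigma> P)) \<le> 1 + ((card P)\<^sup>2 + 1) * (card P + 1)"
      using card_halfplane_traces[OF fin, of "\<lambda>p. \<sigma> * p$2" "\<lambda>p. p$1"] fH[of \<sigma>]
      unfolding halfplane_traces_def[symmetric] by (simp add: card_insert_if)
    also have "\<dots> \<le> n ^ 4"
      using that by (simp add: n_def eval_nat_numeral algebra_simps)
    finally show ?thesis .
  qed
  have S: "card (slab_traces P) \<le> n ^ 2"
  proof -
    have "card (slab_traces P) \<le> card (P \<times> P)"
      unfolding slab_traces_def using fin by (intro card_image_le) simp
    also have "\<dots> \<le> n ^ 2" by (simp add: card_cartesian_product n_def power2_eq_square)
    finally show ?thesis .
  qed
  show "card (insert {} (trapezoid_traces P)) \<le> (card P + 1) ^ 11"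
  proof (cases "card P = 0")
    case True
    then have "P = {}" using fin by simp
    then have "trapezoid_traces P = {}" by (simp add: trapezoid_traces_def slab_traces_def)
    then show ?thesis by simp
  next
    case False
    have "card (trapezoid_traces P) \<le>
        card (insert P (halfplane_traces 1 P) \<times> insert P (halfplane_traces (-1) P) \<times> slab_traces P)"
      unfolding trapezoid_traces_def using fH fS by (intro card_image_le) auto
    also have "\<dots> = card (insert P (halfplane_traces 1 P)) *
        (card (insert P (halfplane_traces (-1) P)) * card (slab_traces P))"
      by (simp only: card_cartesian_product)
    also have "\<dots> \<le> n ^ 4 * (n ^ 4 * n ^ 2)"
      by (intro mult_le_mono H S) (use False in auto)
    finally have T: "card (trapezoid_traces P) \<le> n ^ 10" by (simp add: power_add[symmetric])
    from False have "1 + n ^ 10 \<le> n * n ^ 10"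
    proof -
      have "2 \<le> n" "1 \<le> n ^ 10" using False by (auto simp: n_def)
      then show ?thesis using mult_le_mono1[of 2 n "n ^ 10"] by linarith
    qed
    then show ?thesis using T fT unfolding n_def[symmetric]
      by (simp add: card_insert_if power_Suc[symmetric] del: power_Suc)
  qed
qed

text \<open>Each subfamily is listed and padded with empty sets to length exactly \<open>m\<close>,
  which leaves its union unchanged; then lists are counted.\<close>

lemma card_small_unions:
  assumes "finite \<T>"
  shows "card {\<Union>T | T. T \<subseteq> \<T> \<and> finite T \<and> card T \<le> m} \<le> card (insert {} \<T>) ^ m"
    and "finite {\<Union>T | T. T \<subseteq> \<T> \<and> finite T \<and> card T \<le> m}"
proof -
  let ?L = "{xs. set xs \<subseteq> insert {} \<T> \<and> length xs = m}"
  let ?U = "{\<Union>T | T. T \<subseteq> \<T> \<and> finite T \<and> card T \<le> m}"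
  have fL: "finite ?L" using assms finite_lists_length_eq[of "insert {} \<T>"] by simp
  have "?U \<subseteq> (\<lambda>xs. \<Union>(set xs)) ` ?L"
  proof clarify
    fix T assume T: "T \<subseteq> \<T>" "finite T" "card T \<le> m"
    obtain xs where xs: "set xs = T" "distinct xs" using finite_distinct_list[OF T(2)] by blast
    have "length xs = card T" using xs distinct_card by fastforce
    then have "xs @ replicate (m - card T) {} \<in> ?L"
      using T xs by auto
    moreover have "\<Union>T = \<Union>(set (xs @ replicate (m - card T) {}))"
      using xs by auto
    ultimately show "\<Union>T \<in> (\<lambda>xs. \<Union>(set xs)) ` ?L" by blast
  qed
  then show "finite ?U" "card ?U \<le> card (insert {} \<T>) ^ m"
    using fL finite_surj surj_card_le[OF fL] card_lists_length_eq[of "insert {} \<T>" m] assms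
    by (fastforce, fastforce)
qed

section \<open>Avoidable bipartitions\<close>

text \<open>Replacing each convex piece by the hull of the points of \<open>P\<close> in it keeps
  the pieces disjoint and makes them compact. The \<open>2 * s\<close> hulls then need at most
  \<open>5 * (2 * s)\<close> trapezoids.\<close>

lemma avoidable_bipartition:
  fixes P A :: "(real^2) set"
  assumes fin: "finite P" and A: "A \<subseteq> P"
    and avoid: "\<not> unavoidable_partition 2 (\<lambda>_. s) P (\<lambda>i. if i = 1 then A else P - A)"
  shows "A \<in> {\<Union>T | T. T \<subseteq> trapezoid_traces P \<and> finite T \<and> card T \<le> 10 * s}"
proof -
  let ?Q = "\<lambda>i::nat. if i = 1 then A else P - A"
  have two: "{1..2::nat} = {1,2}" by auto
  have "disjoint_family_on ?Q {1..2}" "(\<Union>i\<in>{1..2}. ?Q i) = P"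
    using A unfolding two disjoint_family_on_def by auto
  then obtain C where C: "\<forall>i\<in>{1..2}. disjoint_convex_union s (C i) \<and> ?Q i \<subseteq> C i"
      "(\<Inter>i\<in>{1..2}. C i) = {}"
    using avoid unfolding unavoidable_partition_def by blast
  then have C12: "A \<subseteq> C 1" "P - A \<subseteq> C 2" "C 1 \<inter> C 2 = {}" unfolding two by auto
  have "\<exists>D. (\<forall>j\<in>{1..s}. convex (D j)) \<and> disjoint_family_on D {1..s} \<and> C i = (\<Union>j\<in>{1..s}. D j)"
    if "i \<in> {1..2}" for i
    using C(1) that unfolding disjoint_convex_union_def by blast
  then obtain D where D: "\<And>i. i \<in> {1..2} \<Longrightarrow> (\<forall>j\<in>{1..s}. convex (D i j)) \<and>
      disjoint_family_on (D i) {1..s} \<and> C i = (\<Union>j\<in>{1..s}. D i j)"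
    by metis
  define I where "I = {1..2::nat} \<times> {1..s}"
  define K where "K z = convex hull (P \<inter> D (fst z) (snd z))" for z
  have KD: "K z \<subseteq> D (fst z) (snd z)" if z: "z \<in> I" for z
    unfolding K_def using D[of "fst z"] z unfolding I_def
    by (intro hull_minimal) (auto simp: mem_Times_iff)
  have PK: "P \<inter> D (fst z) (snd z) \<subseteq> K z" for z
    unfolding K_def by (rule hull_subset)
  have DC: "D (fst z) (snd z) \<subseteq> C (fst z)" if z: "z \<in> I" for z
    using D[of "fst z"] z unfolding I_def by (auto simp: mem_Times_iff)
  interpret disjoint_convex_family I K P
  proof
    show "finite I" "finite P" using fin by (auto simp: I_def)
    show "convex (K z)" "compact (K z)" for z
      using fin by (auto simp: K_def intro: finite_imp_compact_convex_hull)
    show "K z \<inter> K w = {}" if zw: "z \<in> I" "w \<in> I" "z \<noteq> w" for z w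
    proof (cases "fst z = fst w")
      case True
      then have "snd z \<noteq> snd w" using zw by (auto simp: prod_eq_iff)
      then have "D (fst z) (snd z) \<inter> D (fst w) (snd w) = {}"
        using D[of "fst z"] zw True unfolding I_def disjoint_family_on_def
        by (auto simp: mem_Times_iff)
      then show ?thesis using KD zw by blast
    next
      case False
      then have "C (fst z) \<inter> C (fst w) = {}"
        using zw C12(3) unfolding I_def two by (auto simp: mem_Times_iff)
      then show ?thesis using KD DC zw by blast
    qed
    show "P \<subseteq> (\<Union>z\<in>I. K z)"
    proof
      fix p assume p: "p \<in> P"
      then obtain i where i: "i \<in> {1..2}" "p \<in> C i" using C12 unfolding two by blast
      then obtain j where j: "j \<in> {1..s}" "p \<in> D i j" using D by blast
      have "p \<in> K (i,j)" using PK[of "(i,j)"] p j by auto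
      moreover have "(i,j) \<in> I" using i j unfolding I_def by blast
      ultimately show "p \<in> (\<Union>z\<in>I. K z)" by blast
    qed
  qed
  let ?J = "{1} \<times> {1..s}"
  have J: "?J \<subseteq> I" unfolding I_def by auto
  \<comment> \<open>A point of \<open>P\<close> in a hull of the first colour lies in
    \<open>C 1\<close>, hence outside \<open>C 2\<close>, which contains
    \<open>P - A\<close>.\<close>
  have "P \<inter> (\<Union>z\<in>?J. K z) = A"
  proof
    show "P \<inter> (\<Union>z\<in>?J. K z) \<subseteq> A"
    proof
      fix p assume "p \<in> P \<inter> (\<Union>z\<in>?J. K z)"
      then obtain z where z: "p \<in> P" "z \<in> ?J" "p \<in> K z" by blast
      then have "p \<in> C (fst z)" using KD[of z] DC[of z] J by blast
      then show "p \<in> A" using z C12 by auto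
    qed
    show "A \<subseteq> P \<inter> (\<Union>z\<in>?J. K z)"
    proof
      fix p assume p: "p \<in> A"
      then obtain j where j: "j \<in> {1..s}" "p \<in> D 1 j" using D[of 1] C12(1) by auto
      have "p \<in> K (1,j)" using PK[of "(1,j)"] p A j by auto
      moreover have "(1,j) \<in> ?J" using j by blast
      ultimately show "p \<in> P \<inter> (\<Union>z\<in>?J. K z)" using p A by blast
    qed
  qed
  moreover have "5 * card I = 10 * s" by (simp add: I_def card_cartesian_product)
  moreover obtain T where "T \<subseteq> trapezoid_traces P \<and> finite T \<and> card T \<le> 5 * card I \<and>
      \<Union>T = P \<inter> (\<Union>z\<in>?J. K z)"
    using union_of_trapezoids[OF J] ..
  ultimately show ?thesis by (intro CollectI exI[of _ T]) simp
qed

text \<open>Otherwise every subset of \<open>P\<close> is a union of at most \<open>10 * s\<close>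
  of the at most \<open>(card P + 1) ^ 11\<close> traces, which leaves too few subsets; hence 110 =
  11 * 10.\<close>

lemma exists_unavoidable_bipartition:
  fixes P :: "(real^2) set"
  assumes fin: "finite P" and less: "(card P + 1) ^ (110 * s) < 2 ^ card P"
  shows "\<exists>Q. unavoidable_partition 2 (\<lambda>_. s) P Q"
proof (rule ccontr)
  assume none: "\<not> ?thesis"
  let ?U = "{\<Union>T | T. T \<subseteq> trapezoid_traces P \<and> finite T \<and> card T \<le> 10 * s}"
  have fT: "finite (trapezoid_traces P)" by (rule card_trapezoid_traces(2)[OF fin])
  have "Pow P \<subseteq> ?U"
    using avoidable_bipartition[OF fin] none by blast
  then have "card (Pow P) \<le> card ?U"
    by (rule card_mono[OF card_small_unions(2)[OF fT]])
  also have "\<dots> \<le> card (insert {} (trapezoid_traces P)) ^ (10 * s)"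
    by (rule card_small_unions(1)[OF fT])
  also have "\<dots> \<le> ((card P + 1) ^ 11) ^ (10 * s)"
    by (rule power_mono[OF card_trapezoid_traces(1)[OF fin]]) simp
  also have "\<dots> = (card P + 1) ^ (110 * s)" by (simp only: power_mult[symmetric] mult.assoc[symmetric]) simp
  finally show False using less by (simp add: card_Pow fin)
qed

text \<open>The constant is 3^9 - 1: it gives n + 1 \<le> 3^9 * s^2 \<le> s^11, so the left side is
  at most exp (1210 * s * ln s), while ln 2 \<ge> 2/3 makes the right side far larger.\<close>

lemma power_less_two_power:
  fixes s n :: nat
  assumes s: "3 \<le> s" and n: "n = nat \<lceil>19682 * real s * ln (real s)\<rceil>"
  shows "(n + 1) ^ (110 * s) < 2 ^ n"
proof -
  let ?L = "real s * ln (real s)"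
  have s3: "3 \<le> real s" using s by simp
  have "exp 1 \<le> real s" using exp_le s3 by linarith
  then have ln1: "1 \<le> ln (real s)" using s3 by (subst ln_ge_iff) auto
  have L3: "3 \<le> ?L" using mult_mono[of 3 "real s" 1 "ln (real s)"] s3 ln1 by simp
  have nn: "19682 * ?L \<le> real n" "real n \<le> 19682 * ?L + 1"
    unfolding n using L3 by (simp_all add: mult.assoc)
  have "ln (real s) \<le> real s" using ln_le_minus_one[of "real s"] s3 by linarith
  then have "?L \<le> (real s)\<^sup>2" using s3 by (simp add: power2_eq_square)
  moreover have "9 \<le> (real s)\<^sup>2" using power_mono[OF s3, of 2] by simp
  ultimately have "real n + 1 \<le> 3 ^ 9 * (real s)\<^sup>2" using nn(2) by simp
  also have "\<dots> \<le> real s ^ 9 * (real s)\<^sup>2"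
    using power_mono[OF s3, of 9] by (intro mult_right_mono) auto
  also have "\<dots> = real s ^ 11" by (simp add: power_add[symmetric])
  finally have "(real n + 1) ^ (110 * s) \<le> (real s ^ 11) ^ (110 * s)"
    by (intro power_mono) auto
  also have "\<dots> = exp (1210 * ?L)"
  proof -
    have "(real s ^ 11) ^ (110 * s) = exp (ln (real s)) ^ (1210 * s)"
      using s3 by (simp add: power_mult[symmetric] mult.assoc[symmetric])
    also have "\<dots> = exp (real (1210 * s) * ln (real s))" by (rule exp_of_nat_mult[symmetric])
    finally show ?thesis by (simp add: mult_ac)
  qed
  also have "\<dots> < exp (real n * ln 2)"
  proof -
    have "1210 * ?L < 19682 * ?L * (2/3)" using L3 by simp
    also have "\<dots> \<le> real n * ln 2"
      using nn(1) L3 ln2_ge_two_thirds by (intro mult_mono) auto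
    finally show ?thesis by simp
  qed
  also have "\<dots> = 2 ^ n" by (simp add: exp_of_nat_mult)
  finally have "real ((n + 1) ^ (110 * s)) < real (2 ^ n)" by (simp add: add.commute)
  then show ?thesis by (simp only: of_nat_less_iff)
qed

theorem theorem1p6:
  "\<exists>c::real. c > 0 \<and>
     (\<forall>s::nat. s \<ge> 3 \<longrightarrow>
        ereal_of_enat (F TYPE(2) 2 (\<lambda>_. s)) \<le> ereal (c * real s * ln (real s)))"
\<comment> \<open>One more than the constant 19682 in \<open>n\<close>: since
  \<open>s * ln s\<close> is at least 1, the extra unit absorbs the rounding up.\<close>
proof (intro exI[of _ 19683] conjI allI impI)
  fix s :: nat assume s: "s \<ge> 3"
  define n where "n = nat \<lceil>19682 * real s * ln (real s)\<rceil>"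
  have "n \<in> {n. \<forall>P :: (real^2) set. finite P \<and> card P = n
               \<longrightarrow> (\<exists>Q. unavoidable_partition 2 (\<lambda>_. s) P Q)}"
    using exists_unavoidable_bipartition power_less_two_power[OF s n_def] by blast
  then have "F TYPE(2) 2 (\<lambda>_. s) \<le> enat n"
    unfolding F_def by (rule INF_lower)
  then have "ereal_of_enat (F TYPE(2) 2 (\<lambda>_. s)) \<le> ereal_of_enat (enat n)"
    by (simp only: ereal_of_enat_le_iff)
  also have "\<dots> \<le> ereal (19683 * real s * ln (real s))"
  proof -
    have "exp 1 \<le> real s" using exp_le s by (simp add: order_trans[of _ 3])
    then have "1 \<le> ln (real s)" using s by (subst ln_ge_iff) auto
    then have "1 \<le> real s * ln (real s)" using mult_mono[of 1 "real s" 1 "ln (real s)"] s by simp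
    then show ?thesis unfolding n_def by (simp add: mult.assoc) linarith
  qed
  finally show "ereal_of_enat (F TYPE(2) 2 (\<lambda>_. s)) \<le> ereal (19683 * real s * ln (real s))" .
qed simp

end
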